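(* The functionals $F:\Psi_\infty\to\Pi_0$ and $G:\Pi_0\to\Psi_\infty$ induce bijections between the sets of equivalence classes $\Psi_\infty/\!\sim_\infty$ and $\Pi_0/\!\sim_0$. Furthermore, the induced maps are inverse to each other.
   Context: "Increasing" means nondecreasing. $\Pi_0$ is the set of nonnegative integrable functions $\pi$ on $[0,1]$ for which there exist $\epsilon_\pi\in(0,1)$ and $\delta_\pi>0$ such that $\pi(\epsilon)\ge\delta_\pi$ on $(0,\epsilon_\pi)$ and $\epsilon\pi(\epsilon)$ is increasing on $(0,\epsilon_\pi)$. $\Psi_\infty$ is the set of functions $\psi$ for which there exist $M_\psi>0$ and $\delta_\psi>0$ such that: (1) $\psi$ is a positive increasing function on $(M_\psi,\infty)$; (2) $\int_{M_\psi}^\infty\psi(\lambda)e^{-\psi(\lambda)^2/2}\frac{d\lambda}{\lambda}<\infty$; (3) $\lambda\psi(\lambda)e^{-\psi(\lambda)^2/2}>\delta_\psi$ for $\lambda>M_\psi$. The functionals are $$F[\psi](\epsilon)=\frac{\psi(1/\epsilon)}{\epsilon}\exp\bigl(-\psi(1/\epsilon)^2/2\bigr),$$ $$G[\pi](\lambda)=\sqrt{\beta(1/\lambda)+\ln\beta(1/\lambda)},\qquad\beta(\epsilon)=\max\bigl(-2\ln(\epsilon\pi(\epsilon)),1\bigr).$$ Only sufficiently small $\epsilon$ and sufficiently large $\lambda$ matter: $F[\psi]$ is given by the formula for $0<\epsilon<\min(1,1/M_\psi)$ and is set to $0$ elsewhere on $[0,1]$; $G[\pi]$ is considered for $\lambda$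 sufficiently large (e.g. $\lambda>1/\epsilon_\pi$). With these conventions $F$ maps $\Psi_\infty$ into $\Pi_0$ and $G$ maps $\Pi_0$ into $\Psi_\infty$. Equivalence relations: for $\pi_1,\pi_2\in\Pi_0$, $\pi_1\sim_0\pi_2$ if $$0<\liminf_{\epsilon\downarrow0}\frac{\pi_2(\epsilon)}{\pi_1(\epsilon)}\le\limsup_{\epsilon\downarrow0}\frac{\pi_2(\epsilon)}{\pi_1(\epsilon)}<\infty;$$ for $\psi_1,\psi_2\in\Psi_\infty$, $\psi_1\sim_\infty\psi_2$ if $$0<\liminf_{\lambda\uparrow\infty}\frac{\exp(\psi_2(\lambda)^2/2)}{\exp(\psi_1(\lambda)^2/2)}\le\limsup_{\lambda\uparrow\infty}\frac{\exp(\psi_2(\lambda)^2/2)}{\exp(\psi_1(\lambda)^2/2)}<\infty .$$ *)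

theory Defs
  imports "HOL-Analysis.Analysis"
begin

text \<open>Functions on \<open>[0,1]\<close> and functions defined near infinity are modelled as total functions on
  the reals. Values outside the relevant domain are unconstrained; the equivalence relations below
  depend only on the behaviour near \<open>0\<close> from the right and near infinity, respectively.\<close>

definition Pi0 :: "(real \<Rightarrow> real) set" where
  "Pi0 = {\<pi>. (\<forall>\<epsilon>\<in>{0..1}. \<pi> \<epsilon> \<ge> 0) \<and> set_integrable lebesgue {0..1} \<pi> \<and>
     (\<exists>\<epsilon>\<^sub>\<pi>\<in>{0<..<1}. \<exists>\<delta>\<^sub>\<pi>>0. (\<forall>\<epsilon>\<in>{0<..<\<epsilon>\<^sub>\<pi>}. \<pi> \<epsilon> \<ge> \<delta>\<^sub>\<pi>) \<and>
        mono_on {0<..<\<epsilon>\<^sub>\<pi>} (\<lambda>\<epsilon>. \<epsilon> * \<pi> \<epsilon>))}"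

text \<open>\<open>Psi_threshold M \<psi>\<close> says that \<open>M\<close> is an admissible choice of the number \<open>M\<^sub>\<psi>\<close>.
  The integrand in the second condition is nonnegative and measurable, so finiteness of
  the integral is integrability.\<close>

definition Psi_threshold :: "real \<Rightarrow> (real \<Rightarrow> real) \<Rightarrow> bool" where
  "Psi_threshold M \<psi> \<longleftrightarrow> M > 0 \<and> (\<exists>\<delta>\<^sub>\<psi>>0.
     (\<forall>x\<in>{M<..}. \<psi> x > 0) \<and> mono_on {M<..} \<psi> \<and>
     set_integrable lebesgue {M<..} (\<lambda>x. \<psi> x * exp (- (\<psi> x)\<^sup>2 / 2) / x) \<and>
     (\<forall>x>M. x * \<psi> x * exp (- (\<psi> x)\<^sup>2 / 2) > \<delta>\<^sub>\<psi>))"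

definition Psi_inf :: "(real \<Rightarrow> real) set" where
  "Psi_inf = {\<psi>. \<exists>M. Psi_threshold M \<psi>}"

text \<open>The cut-off in \<open>F\<close> depends on the chosen threshold \<open>M = M\<^sub>\<psi>\<close>, which \<open>\<psi>\<close> does not determine,
  so it is a parameter.\<close>

definition F :: "real \<Rightarrow> (real \<Rightarrow> real) \<Rightarrow> real \<Rightarrow> real" where
  "F M \<psi> \<epsilon> = (if 0 < \<epsilon> \<and> \<epsilon> < min 1 (1 / M)
     then \<psi> (1 / \<epsilon>) / \<epsilon> * exp (- (\<psi> (1 / \<epsilon>))\<^sup>2 / 2) else 0)"

definition beta :: "(real \<Rightarrow> real) \<Rightarrow> real \<Rightarrow> real" where
  "beta \<pi> \<epsilon> = max (- 2 * ln (\<epsilon> * \<pi> \<epsilon>)) 1"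

definition G :: "(real \<Rightarrow> real) \<Rightarrow> real \<Rightarrow> real" where
  "G \<pi> x = sqrt (beta \<pi> (1 / x) + ln (beta \<pi> (1 / x)))"

definition sim0 :: "((real \<Rightarrow> real) \<times> (real \<Rightarrow> real)) set" where
  "sim0 = {(\<pi>1, \<pi>2). \<pi>1 \<in> Pi0 \<and> \<pi>2 \<in> Pi0 \<and>
     (let r = (\<lambda>\<epsilon>. ereal (\<pi>2 \<epsilon> / \<pi>1 \<epsilon>)) in
      0 < Liminf (at_right 0) r \<and> Liminf (at_right 0) r \<le> Limsup (at_right 0) r \<and>
      Limsup (at_right 0) r < \<infinity>)}"

definition sim_inf :: "((real \<Rightarrow> real) \<times> (real \<Rightarrow> real)) set" where
  "sim_inf = {(\<psi>1, \<psi>2). \<psi>1 \<in> Psi_inf \<and> \<psi>2 \<in> Psi_inf \<and>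
     (let r = (\<lambda>x. ereal (exp ((\<psi>2 x)\<^sup>2 / 2) / exp ((\<psi>1 x)\<^sup>2 / 2))) in
      0 < Liminf at_top r \<and> Liminf at_top r \<le> Limsup at_top r \<and> Limsup at_top r < \<infinity>)}"

text \<open>The map on classes induced by \<open>f\<close>, with values in the classes of \<open>S\<close>. If \<open>f\<close> sends related
  elements to \<open>S\<close>-related elements, it maps the class of \<open>x\<close> to the class of \<open>f x\<close>.\<close>

definition induced :: "('b \<times> 'b) set \<Rightarrow> ('a \<Rightarrow> 'b) \<Rightarrow> 'a set \<Rightarrow> 'b set" where
  "induced S f X = (\<Union>x\<in>X. S `` {f x})"

end

theory Submission
  imports Defs
begin

text \<open>In logarithmic form \<open>\<sim>\<^sub>0\<close> says that \<open>ln \<pi>\<^sub>2 - ln \<pi>\<^sub>1\<close> is bounded near \<open>0\<close>, and \<open>\<sim>\<^sub>\<infinity>\<close> says that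
  \<open>\<psi>\<^sub>2\<^sup>2 - \<psi>\<^sub>1\<^sup>2\<close> is bounded near infinity. With \<open>\<lambda> = 1/\<epsilon>\<close> one has
  \<open>ln (\<epsilon> F[\<psi>](\<epsilon>)) = ln \<psi>(\<lambda>) - \<psi>(\<lambda>)\<^sup>2/2\<close> and \<open>G[\<pi>](\<lambda>)\<^sup>2 = \<beta>(\<epsilon>) + ln \<beta>(\<epsilon>)\<close>. Since \<open>ln\<close> is 1-Lipschitz
  on \<open>[1,\<infinity>)\<close>, both maps respect the relations as soon as \<open>\<psi> \<ge> 1\<close> near infinity, which holds because
  \<open>1/\<lambda>\<close> is not integrable there. The elementary bounds
  \<open>0 \<le> ln g - g\<^sup>2/2 + \<beta>/2 \<le> 1/2\<close> for \<open>g\<^sup>2 = \<beta> + ln \<beta>\<close>, \<open>\<beta> \<ge> 1\<close>, and \<open>t - ln t \<ge> t/2\<close> for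
  \<open>t = \<psi>\<^sup>2\<close> show that \<open>F\<close> and \<open>G\<close> invert each other up to bounded logarithmic errors.\<close>

section \<open>Elementary inequalities for the logarithm and for x exp(-x^2/2)\<close>

lemma ln_abs_diff_le:
  fixes a b :: real
  assumes "a \<ge> 1" "b \<ge> 1"
  shows "\<bar>ln a - ln b\<bar> \<le> \<bar>a - b\<bar>"
proof -
  have *: "ln x - ln y \<le> x - y" if "1 \<le> y" "y \<le> x" for x y :: real
  proof -
    have "ln x - ln y \<le> (x - y) / y"
      using that by (intro ln_diff_le) auto
    also have "\<dots> \<le> (x - y) / 1"
      using that by (intro divide_left_mono) auto
    finally show ?thesis by simp
  qed
  have "ln a \<le> ln b" if "a \<le> b" using that assms by simp
  moreover have "ln b \<le> ln a" if "b \<le> a" using that assms by simp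
  ultimately show ?thesis
    using *[of a b] *[of b a] assms by linarith
qed

text \<open>The tangent of ln at 2 gives ln t <= t/2 - 1 + ln 2, and ln 2 <= 1.\<close>

lemma ln_le_half:
  fixes t :: real
  assumes "t > 0"
  shows "ln t \<le> t / 2"
proof -
  have "ln (t / 2) \<le> t / 2 - 1" "ln (2::real) \<le> 2 - 1"
    using assms by (intro ln_le_minus_one; simp)+
  then show ?thesis using assms by (simp add: ln_div)
qed

text \<open>The bounded quantity is half of ln ((b + ln b) / b), and this ratio lies between 1 and 2
  because 0 <= ln b <= b. The constant 1/2 comes from ln 2 <= 1.\<close>

lemma ln_sqrt_plus_ln_bounds:
  fixes b :: real
  assumes "b \<ge> 1"
  defines "g \<equiv> sqrt (b + ln b)"
  shows "0 \<le> ln g - g\<^sup>2 / 2 + b / 2" "ln g - g\<^sup>2 / 2 + b / 2 \<le> 1 / 2"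
proof -
  have pos: "b + ln b > 0" and l0: "0 \<le> ln b" using assms by (auto simp: add_pos_nonneg)
  have lb: "ln b \<le> b" using ln_le_half[of b] assms by simp
  have eq: "ln g - g\<^sup>2 / 2 + b / 2 = (ln (b + ln b) - ln b) / 2"
    using pos by (simp add: g_def ln_sqrt field_simps)
  have "ln b \<le> ln (b + ln b)" using l0 assms pos by (subst ln_le_cancel_iff) auto
  moreover have "ln (b + ln b) \<le> ln (2 * b)" using lb assms pos by simp
  moreover have "ln (2 * b) = ln 2 + ln b" using assms by (simp add: ln_mult)
  moreover have "ln (2::real) \<le> 2 - 1" by (rule ln_le_minus_one) simp
  ultimately show "0 \<le> ln g - g\<^sup>2 / 2 + b / 2" "ln g - g\<^sup>2 / 2 + b / 2 \<le> 1 / 2"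
    unfolding eq by simp_all
qed

lemma mult_exp_neg_half_square:
  fixes x :: real
  assumes "x > 0"
  shows "x * exp (- x\<^sup>2 / 2) = exp (ln x - x\<^sup>2 / 2)"
  using assms exp_add[of "ln x" "- x\<^sup>2 / 2"] by simp

text \<open>Exponentiate the previous bounds. For \<open>b = beta \<pi> \<epsilon>\<close> this
  compares G exp(-G^2/2) with exp(-beta/2), which \<open>exp_beta\<close> expresses through
  \<epsilon> \<pi>(\<epsilon>).\<close>

lemma mult_exp_sqrt_plus_ln_bounds:
  fixes b :: real
  assumes "b \<ge> 1"
  defines "g \<equiv> sqrt (b + ln b)"
  shows "exp (- b / 2) \<le> g * exp (- g\<^sup>2 / 2)" "g * exp (- g\<^sup>2 / 2) \<le> exp (1 / 2) * exp (- b / 2)"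
proof -
  have "b + ln b > 0" using assms by (auto simp: add_pos_nonneg)
  then have "g > 0" by (simp add: g_def)
  note eq = mult_exp_neg_half_square[OF this]
  have "- b / 2 \<le> ln g - g\<^sup>2 / 2" "ln g - g\<^sup>2 / 2 \<le> 1 / 2 + - b / 2"
    using ln_sqrt_plus_ln_bounds[OF assms(1)] unfolding g_def by linarith+
  then show "exp (- b / 2) \<le> g * exp (- g\<^sup>2 / 2)"
    "g * exp (- g\<^sup>2 / 2) \<le> exp (1 / 2) * exp (- b / 2)"
    unfolding eq exp_add[symmetric] by simp_all
qed

text \<open>For x >= 1, ln x - x^2/2 is half of ln (x^2) - x^2, which decreases because ln is
  1-Lipschitz on [1, infinity). This yields the monotonicity of \<epsilon> F(\<epsilon>) near
  0.\<close>

lemma mult_exp_neg_square_antimono: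
  fixes x y :: real
  assumes "1 \<le> x" "x \<le> y"
  shows "y * exp (- y\<^sup>2 / 2) \<le> x * exp (- x\<^sup>2 / 2)"
proof -
  have "\<bar>ln (y\<^sup>2) - ln (x\<^sup>2)\<bar> \<le> \<bar>y\<^sup>2 - x\<^sup>2\<bar>"
    using assms by (intro ln_abs_diff_le) (auto intro: one_le_power)
  moreover have "x\<^sup>2 \<le> y\<^sup>2" using assms by (intro power_mono) auto
  ultimately have "ln y - y\<^sup>2 / 2 \<le> ln x - x\<^sup>2 / 2"
    using assms by (simp add: ln_realpow)
  then show ?thesis
    using assms mult_exp_neg_half_square[of x] mult_exp_neg_half_square[of y] by simp
qed

section \<open>Integrability near infinity and the substitution x -> 1/x\<close>

lemma not_set_integrable_inverse_at_top:
  fixes a :: real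
  assumes "a > 0"
  shows "\<not> set_integrable lebesgue {a<..} (\<lambda>x. 1 / x)"
proof
  assume A: "set_integrable lebesgue {a<..} (\<lambda>x. 1 / x)"
  define I where "I = integral {a<..} (\<lambda>x::real. 1 / x)"
  have int: "(\<lambda>x::real. 1 / x) integrable_on {a<..}"
    using A by (rule set_lebesgue_integral_eq_integral)
  have bound: "ln b - ln (2 * a) \<le> I" if "b \<ge> 2 * a" for b
  proof -
    have fi: "((\<lambda>x. 1 / x) has_integral (ln b - ln (2 * a))) {2 * a..b}"
      using that assms
      by (intro fundamental_theorem_of_calculus)
         (auto intro!: derivative_eq_intros simp flip: has_real_derivative_iff_has_vector_derivative)
    then have "ln b - ln (2 * a) = integral {2 * a..b} (\<lambda>x. 1 / x)"
      by (simp add: integral_unique)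
    also have "\<dots> \<le> I"
      unfolding I_def using assms fi int
      by (intro integral_subset_le) (auto simp: has_integral_integrable)
    finally show ?thesis .
  qed
  \<comment> \<open>This \<open>b\<close> makes ln b - ln (2a) equal to |I| + 1, which exceeds
    I.\<close>
  define b where "b = 2 * a * exp (\<bar>I\<bar> + 1)"
  have "b \<ge> 2 * a * 1" unfolding b_def using assms by (intro mult_left_mono) auto
  then have "ln b - ln (2 * a) \<le> I" using bound by simp
  moreover have "ln b = ln (2 * a) + (\<bar>I\<bar> + 1)" unfolding b_def using assms by (simp add: ln_mult)
  ultimately show False by linarith
qed

lemma image_inverse_greaterThan:
  fixes a :: real
  assumes "a > 0"
  shows "(\<lambda>x. 1 / x) ` {a<..} = {0<..<1 / a}" "(\<lambda>x. 1 / x) ` {0<..<1 / a} = {a<..}"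
proof -
  have *: "x \<in> (\<lambda>x. 1 / x) ` S" if "1 / x \<in> S" for x :: real and S
    using that by (intro image_eqI[of _ _ "1 / x"]) auto
  show "(\<lambda>x. 1 / x) ` {a<..} = {0<..<1 / a}" "(\<lambda>x. 1 / x) ` {0<..<1 / a} = {a<..}"
    using assms by (auto intro!: * simp: field_simps)
qed

text \<open>The map x -> 1/x is injective with derivative -1/x^2. The equivalence carries
  integrability from infinity to 0 for \<open>F\<close> and from 0 to infinity for
  \<open>G\<close>.\<close>

lemma set_integrable_inverse_substitution:
  fixes f :: "real \<Rightarrow> real" and S :: "real set"
  assumes "S \<in> sets lebesgue" "S \<subseteq> {0<..}"
  shows "set_integrable lebesgue ((\<lambda>x. 1 / x) ` S) f \<longleftrightarrow>
    set_integrable lebesgue S (\<lambda>x. f (1 / x) / x\<^sup>2)"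
proof -
  have "set_integrable lebesgue ((\<lambda>x. 1 / x) ` S) f \<longleftrightarrow>
      set_integrable lebesgue S (\<lambda>x. \<bar>- 1 / x\<^sup>2\<bar> * f (1 / x))"
    using assms
    by (intro absolutely_integrable_change_of_variables_1')
       (auto intro!: derivative_eq_intros inj_onI simp: power2_eq_square)
  then show ?thesis by simp
qed

section \<open>Equivalence relations given by bounded differences\<close>

lemma Liminf_Limsup_bounded_iff_ln:
  fixes r :: "'a \<Rightarrow> real"
  assumes "\<forall>\<^sub>F x in L. r x > 0" "L \<noteq> bot"
  shows "(let q = (\<lambda>x. ereal (r x)) in
      0 < Liminf L q \<and> Liminf L q \<le> Limsup L q \<and> Limsup L q < \<infinity>) \<longleftrightarrow>
    (\<exists>K. \<forall>\<^sub>F x in L. \<bar>ln (r x)\<bar> \<le> K)" (is "?LHS \<longleftrightarrow> ?R")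
proof
  assume LHS: ?LHS
  \<comment> \<open>Reals strictly between 0 and the lower limit, and strictly above the upper
    limit, turn the extended limits into eventual real bounds on \<open>r\<close>.\<close>
  then obtain c where c: "0 < ereal c" "ereal c < Liminf L (\<lambda>x. ereal (r x))"
    using ereal_dense2[of 0 "Liminf L (\<lambda>x. ereal (r x))"] by (auto simp: Let_def)
  obtain C where C: "Limsup L (\<lambda>x. ereal (r x)) < ereal C"
    using LHS ereal_dense2[of "Limsup L (\<lambda>x. ereal (r x))" \<infinity>] by (auto simp: Let_def)
  have "\<forall>\<^sub>F x in L. \<bar>ln (r x)\<bar> \<le> \<bar>ln c\<bar> + \<bar>ln C\<bar>"
    using less_LiminfD[OF c(2)] Limsup_lessD[OF C]
  proof eventually_elim
    case (elim x)
    then have "ln c \<le> ln (r x)" "ln (r x) \<le> ln C" using c(1) by auto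
    then show ?case by linarith
  qed
  then show ?R by blast
next
  assume ?R
  then obtain K where K: "\<forall>\<^sub>F x in L. \<bar>ln (r x)\<bar> \<le> K" by blast
  have "\<forall>\<^sub>F x in L. exp (- K) \<le> r x \<and> r x \<le> exp K"
    using K assms(1)
  proof eventually_elim
    case (elim x)
    then have "- K \<le> ln (r x)" "ln (r x) \<le> K" by linarith+
    then show ?case using elim(2) by (auto simp: ln_ge_iff) (metis exp_le_cancel_iff exp_ln)
  qed
  then have e: "\<forall>\<^sub>F x in L. ereal (exp (- K)) \<le> ereal (r x)" "\<forall>\<^sub>F x in L. ereal (r x) \<le> ereal (exp K)"
    by (auto elim: eventually_mono)
  have "0 < ereal (exp (- K))" "ereal (exp K) < \<infinity>" by auto
  then show ?LHS unfolding Let_def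
    using Liminf_bounded[OF e(1)] Limsup_bounded[OF e(2)] Liminf_le_Limsup[OF assms(2)]
    by (meson less_le_trans le_less_trans)
qed

text \<open>Both relations become instances: \<open>h\<close> is the logarithm near 0 and the square
  near infinity. Transitivity is the triangle inequality, the constants adding up.\<close>

lemma equiv_bounded_difference:
  fixes h :: "'a \<Rightarrow> 'b \<Rightarrow> real"
  shows "equiv A {(f, g). f \<in> A \<and> g \<in> A \<and> (\<exists>K. \<forall>\<^sub>F x in L. \<bar>h g x - h f x\<bar> \<le> K)}"
proof (rule equivI)
  show "trans {(f, g). f \<in> A \<and> g \<in> A \<and> (\<exists>K. \<forall>\<^sub>F x in L. \<bar>h g x - h f x\<bar> \<le> K)}"
  proof (rule transI, clarsimp)
    fix f g k K K'
    assume "\<forall>\<^sub>F x in L. \<bar>h g x - h f x\<bar> \<le> K" "\<forall>\<^sub>F x in L. \<bar>h k x - h g x\<bar> \<le> K'"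
    then have "\<forall>\<^sub>F x in L. \<bar>h k x - h f x\<bar> \<le> K + K'"
      by eventually_elim linarith
    then show "\<exists>K. \<forall>\<^sub>F x in L. \<bar>h k x - h f x\<bar> \<le> K" by blast
  qed
qed (auto simp: sym_def refl_on_def abs_minus_commute intro!: exI[of _ 0])

section \<open>Maps induced on quotients\<close>

lemma induced_class:
  assumes "equiv A R" "equiv B S" "\<And>x y. (x, y) \<in> R \<Longrightarrow> (f x, f y) \<in> S" "a \<in> A"
  shows "induced S f (R `` {a}) = S `` {f a}"
proof -
  have "S `` {f x} = S `` {f a}" if "x \<in> R `` {a}" for x
    using that assms(2,3) by (metis Image_singleton_iff equiv_class_eq)
  moreover have "a \<in> R `` {a}" using assms(1,4) by (rule equiv_class_self)
  ultimately show ?thesis unfolding induced_def by blast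
qed

text \<open>It suffices that \<open>f\<close> and \<open>g\<close> invert each other up to
  equivalence: by \<open>induced_class\<close> both composites then fix every class.\<close>

lemma induced_mutually_inverse:
  assumes R: "equiv A R" and S: "equiv B S"
    and f: "f \<in> A \<rightarrow> B" and g: "g \<in> B \<rightarrow> A"
    and fR: "\<And>x y. (x, y) \<in> R \<Longrightarrow> (f x, f y) \<in> S"
    and gS: "\<And>x y. (x, y) \<in> S \<Longrightarrow> (g x, g y) \<in> R"
    and gf: "\<And>a. a \<in> A \<Longrightarrow> (a, g (f a)) \<in> R"
    and fg: "\<And>b. b \<in> B \<Longrightarrow> (b, f (g b)) \<in> S"
  shows "bij_betw (induced S f) (A // R) (B // S)" "bij_betw (induced R g) (B // S) (A // R)"
    "\<forall>X\<in>A // R. induced R g (induced S f X) = X" "\<forall>Y\<in>B // S. induced S f (induced R g Y) = Y"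
proof -
  note cf = induced_class[OF R S fR] and cg = induced_class[OF S R gS]
  show gf': "\<forall>X\<in>A // R. induced R g (induced S f X) = X"
  proof
    fix X assume "X \<in> A // R"
    then obtain a where a: "a \<in> A" "X = R `` {a}" by (auto elim: quotientE)
    with f have "f a \<in> B" by auto
    then have "induced R g (induced S f X) = R `` {g (f a)}" using a by (simp add: cf cg)
    then show "induced R g (induced S f X) = X" using a equiv_class_eq[OF R gf] by simp
  qed
  show fg': "\<forall>Y\<in>B // S. induced S f (induced R g Y) = Y"
  proof
    fix Y assume "Y \<in> B // S"
    then obtain b where b: "b \<in> B" "Y = S `` {b}" by (auto elim: quotientE)
    with g have "g b \<in> A" by auto
    then have "induced S f (induced R g Y) = S `` {f (g b)}" using b by (simp add: cf cg)
    then show "induced S f (induced R g Y) = Y" using b equiv_class_eq[OF S fg] by simp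
  qed
  have mf: "induced S f ` (A // R) \<subseteq> B // S"
    using f by (auto elim!: quotientE simp: cf intro!: quotientI)
  have mg: "induced R g ` (B // S) \<subseteq> A // R"
    using g by (auto elim!: quotientE simp: cg intro!: quotientI)
  show "bij_betw (induced S f) (A // R) (B // S)"
    by (rule bij_betw_byWitness[OF gf' fg' mf mg])
  show "bij_betw (induced R g) (B // S) (A // R)"
    by (rule bij_betw_byWitness[OF fg' gf' mg mf])
qed

section \<open>Behaviour near 0 and infinity, and the relations in logarithmic form\<close>

lemma Pi0_eventually_pos:
  assumes "\<pi> \<in> Pi0"
  shows "\<forall>\<^sub>F \<epsilon> in at_right 0. \<pi> \<epsilon> > 0"
proof -
  obtain e d where "0 < e" "d > 0" and d: "\<forall>\<epsilon>\<in>{0<..<e}. \<pi> \<epsilon> \<ge> d"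
    using assms by (auto simp: Pi0_def)
  have "\<forall>\<^sub>F \<epsilon> in at_right 0. \<epsilon> \<in> {0<..<e}"
    using \<open>0 < e\<close> by (rule eventually_at_right_real)
  then show ?thesis by eventually_elim (use d \<open>d > 0\<close> in force)
qed

lemma sim0_eq:
  "sim0 = {(\<pi>1, \<pi>2). \<pi>1 \<in> Pi0 \<and> \<pi>2 \<in> Pi0 \<and>
    (\<exists>K. \<forall>\<^sub>F \<epsilon> in at_right 0. \<bar>ln (\<pi>2 \<epsilon>) - ln (\<pi>1 \<epsilon>)\<bar> \<le> K)}"
proof -
  have "(let r = (\<lambda>\<epsilon>. ereal (\<pi>2 \<epsilon> / \<pi>1 \<epsilon>)) in
      0 < Liminf (at_right 0) r \<and> Liminf (at_right 0) r \<le> Limsup (at_right 0) r \<and>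
      Limsup (at_right 0) r < \<infinity>) \<longleftrightarrow>
    (\<exists>K. \<forall>\<^sub>F \<epsilon> in at_right 0. \<bar>ln (\<pi>2 \<epsilon>) - ln (\<pi>1 \<epsilon>)\<bar> \<le> K)"
    if "\<pi>1 \<in> Pi0" "\<pi>2 \<in> Pi0" for \<pi>1 \<pi>2
  proof -
    note pos = that[THEN Pi0_eventually_pos]
    have q: "\<forall>\<^sub>F \<epsilon> in at_right 0. \<pi>2 \<epsilon> / \<pi>1 \<epsilon> > 0"
      using pos by eventually_elim simp
    have eq: "\<forall>\<^sub>F \<epsilon> in at_right 0. ln (\<pi>2 \<epsilon> / \<pi>1 \<epsilon>) = ln (\<pi>2 \<epsilon>) - ln (\<pi>1 \<epsilon>)"
      using pos by eventually_elim (simp add: ln_div)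
    have "(\<forall>\<^sub>F \<epsilon> in at_right 0. \<bar>ln (\<pi>2 \<epsilon> / \<pi>1 \<epsilon>)\<bar> \<le> K) \<longleftrightarrow>
        (\<forall>\<^sub>F \<epsilon> in at_right 0. \<bar>ln (\<pi>2 \<epsilon>) - ln (\<pi>1 \<epsilon>)\<bar> \<le> K)" for K
      by (rule eventually_cong[OF eq]) simp
    then show ?thesis
      by (subst Liminf_Limsup_bounded_iff_ln[OF q]) (simp_all add: trivial_limit_at_right_real)
  qed
  then show ?thesis unfolding sim0_def by blast
qed

lemma sim_inf_eq:
  "sim_inf = {(\<psi>1, \<psi>2). \<psi>1 \<in> Psi_inf \<and> \<psi>2 \<in> Psi_inf \<and>
    (\<exists>K. \<forall>\<^sub>F x in at_top. \<bar>(\<psi>2 x)\<^sup>2 - (\<psi>1 x)\<^sup>2\<bar> \<le> K)}"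
proof -
  have "(let r = (\<lambda>x. ereal (exp ((\<psi>2 x)\<^sup>2 / 2) / exp ((\<psi>1 x)\<^sup>2 / 2))) in
      0 < Liminf at_top r \<and> Liminf at_top r \<le> Limsup at_top r \<and> Limsup at_top r < \<infinity>) \<longleftrightarrow>
    (\<exists>K. \<forall>\<^sub>F x in at_top. \<bar>(\<psi>2 x)\<^sup>2 - (\<psi>1 x)\<^sup>2\<bar> \<le> K)" (is "?L \<longleftrightarrow> ?R") for \<psi>1 \<psi>2 :: "real \<Rightarrow> real"
  proof -
    have "?L \<longleftrightarrow> (\<exists>K. \<forall>\<^sub>F x in at_top. \<bar>(\<psi>2 x)\<^sup>2 / 2 - (\<psi>1 x)\<^sup>2 / 2\<bar> \<le> K)"
      by (subst Liminf_Limsup_bounded_iff_ln) (simp_all add: ln_div)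
    also have "\<dots> \<longleftrightarrow> (\<exists>K. \<forall>\<^sub>F x in at_top. \<bar>(\<psi>2 x)\<^sup>2 - (\<psi>1 x)\<^sup>2\<bar> \<le> 2 * K)"
      by (simp flip: diff_divide_distrib) (simp add: field_simps)
    also have "\<dots> \<longleftrightarrow> ?R"
    proof
      assume ?R
      then obtain K where "\<forall>\<^sub>F x in at_top. \<bar>(\<psi>2 x)\<^sup>2 - (\<psi>1 x)\<^sup>2\<bar> \<le> 2 * (K / 2)" by auto
      then show "\<exists>K. \<forall>\<^sub>F x in at_top. \<bar>(\<psi>2 x)\<^sup>2 - (\<psi>1 x)\<^sup>2\<bar> \<le> 2 * K" by blast
    qed blast
    finally show ?thesis .
  qed
  then show ?thesis unfolding sim_inf_def by blast
qed

text \<open>If \<psi> stayed below 1, monotonicity would keep it above the positive value \<psi>(M +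
  1), so the integrand would dominate a positive multiple of 1/x, contradicting integrability.
  Monotonicity then extends a single value >= 1 to all larger arguments.\<close>

lemma Psi_threshold_eventually_ge_1:
  assumes "Psi_threshold M \<psi>"
  obtains N where "N \<ge> M" "N \<ge> 1" "\<And>x. x > N \<Longrightarrow> \<psi> x \<ge> 1"
proof -
  have M: "M > 0" and pos: "\<And>x. x > M \<Longrightarrow> \<psi> x > 0" and mono: "mono_on {M<..} \<psi>"
    and int: "set_integrable lebesgue {M<..} (\<lambda>x. \<psi> x * exp (- (\<psi> x)\<^sup>2 / 2) / x)"
    using assms by (auto simp: Psi_threshold_def)
  have "\<exists>a>M. \<psi> a \<ge> 1"
  proof (rule ccontr)
    assume "\<not> ?thesis"
    then have lt: "\<psi> x < 1" if "x > M" for x using that by force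
    \<comment> \<open>The first factor bounds \<psi> from below by monotonicity; the second bounds
      the exponential from below because \<psi> < 1.\<close>
    define c where "c = \<psi> (M + 1) * exp (- 1 / 2)"
    have c: "c > 0" using pos by (simp add: c_def)
    have "set_integrable lebesgue {M + 1<..} (\<lambda>x. c / x)"
    proof (rule set_integrable_bound)
      show "set_integrable lebesgue {M + 1<..} (\<lambda>x. \<psi> x * exp (- (\<psi> x)\<^sup>2 / 2) / x)"
        by (rule set_integrable_subset[OF int]) auto
      show "set_borel_measurable lebesgue {M + 1<..} (\<lambda>x. c / x)"
        unfolding set_borel_measurable_def by (rule measurable_completion) simp
      show "AE x in lebesgue. x \<in> {M + 1<..} \<longrightarrow>
          norm (c / x) \<le> norm (\<psi> x * exp (- (\<psi> x)\<^sup>2 / 2) / x)"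
      proof (intro AE_I2 impI)
        fix x assume "x \<in> {M + 1<..}"
        then have x: "x > M + 1" by simp
        have "\<psi> (M + 1) \<le> \<psi> x" using mono x by (auto intro: mono_onD)
        moreover have "(\<psi> x)\<^sup>2 \<le> 1" using lt[of x] pos[of x] x by (simp add: power_le_one)
        ultimately have "c \<le> \<psi> x * exp (- (\<psi> x)\<^sup>2 / 2)"
          unfolding c_def using pos[of x] x by (intro mult_mono) auto
        then show "norm (c / x) \<le> norm (\<psi> x * exp (- (\<psi> x)\<^sup>2 / 2) / x)"
          using c x M pos[of x] by (simp add: divide_right_mono abs_mult)
      qed
    qed
    then have "set_integrable lebesgue {M + 1<..} (\<lambda>x. (1 / c) * (c / x))"
      by (intro set_integrable_mult_right)
    then show False using c M not_set_integrable_inverse_at_top[of "M + 1"] by simp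
  qed
  then obtain a where a: "a > M" "\<psi> a \<ge> 1" by blast
  show thesis
  proof (rule that[of "max a 1"])
    fix x assume "max a 1 < x"
    then have "\<psi> a \<le> \<psi> x" using a mono by (auto intro: mono_onD)
    then show "\<psi> x \<ge> 1" using a by simp
  qed (use a in auto)
qed

lemma Psi_inf_eventually_ge_1:
  assumes "\<psi> \<in> Psi_inf"
  shows "\<forall>\<^sub>F x in at_top. \<psi> x \<ge> 1"
proof -
  obtain M where "Psi_threshold M \<psi>" using assms by (auto simp: Psi_inf_def)
  then obtain N where "\<And>x. x > N \<Longrightarrow> \<psi> x \<ge> 1"
    by (rule Psi_threshold_eventually_ge_1) blast
  then show ?thesis by (auto simp: eventually_at_top_dense)
qed

section \<open>The functional \<open>F\<close> maps into \<open>Pi0\<close>\<close>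

lemma F_in_Pi0:
  assumes "Psi_threshold M \<psi>"
  shows "F M \<psi> \<in> Pi0"
proof -
  obtain d where M: "M > 0" and pos: "\<And>x. x > M \<Longrightarrow> \<psi> x > 0" and mono: "mono_on {M<..} \<psi>"
    and int: "set_integrable lebesgue {M<..} (\<lambda>x. \<psi> x * exp (- (\<psi> x)\<^sup>2 / 2) / x)"
    and d: "d > 0" "\<And>x. x > M \<Longrightarrow> x * \<psi> x * exp (- (\<psi> x)\<^sup>2 / 2) > d"
    using assms by (auto simp: Psi_threshold_def)
  \<comment> \<open>The support of \<open>F M \<psi>\<close> lies in (0, e); inversion carries this
    interval onto (max 1 M, infinity), where the integrability condition applies.\<close>
  define e where "e = min 1 (1 / M)"
  have e: "e > 0" "e = 1 / max 1 M"
    using M by (cases "M \<le> 1"; simp add: e_def min_def max_def)+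
  have gtM: "1 / \<epsilon> > M" if "\<epsilon> \<in> {0<..<e}" for \<epsilon>
    using that M by (simp add: e_def field_simps)
  have Feq: "F M \<psi> \<epsilon> = \<psi> (1 / \<epsilon>) / \<epsilon> * exp (- (\<psi> (1 / \<epsilon>))\<^sup>2 / 2)" if "\<epsilon> \<in> {0<..<e}" for \<epsilon>
    using that by (auto simp: F_def e_def)
  have F0: "F M \<psi> \<epsilon> = 0" if "\<epsilon> \<notin> {0<..<e}" for \<epsilon>
    using that by (auto simp: F_def e_def)
  have ge0: "F M \<psi> \<epsilon> \<ge> 0" for \<epsilon>
  proof (cases "\<epsilon> \<in> {0<..<e}")
    case True
    then have "\<psi> (1 / \<epsilon>) > 0" using gtM pos by blast
    then show ?thesis using True Feq[OF True] by simp
  qed (simp add: F0)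
  have image: "(\<lambda>x. 1 / x) ` {0<..<e} = {max 1 M<..}"
    unfolding e(2) by (rule image_inverse_greaterThan(2)) simp
  have "set_integrable lebesgue ((\<lambda>x. 1 / x) ` {0<..<e})
      (\<lambda>x. \<psi> x * exp (- (\<psi> x)\<^sup>2 / 2) / x)"
    unfolding image by (rule set_integrable_subset[OF int]) auto
  then have "set_integrable lebesgue {0<..<e}
      (\<lambda>x. \<psi> (1 / x) * exp (- (\<psi> (1 / x))\<^sup>2 / 2) / (1 / x) / x\<^sup>2)"
    by (rule set_integrable_inverse_substitution[THEN iffD1, rotated 2]) auto
  \<comment> \<open>The weight 1/\<lambda> and the Jacobian 1/x^2 combine to the factor 1/x in
    \<open>F\<close>; outside (0, e) both sides vanish.\<close>
  moreover have "indicator {0..1} x *\<^sub>R F M \<psi> x = indicator {0<..<e} x *\<^sub>R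
      (\<psi> (1 / x) * exp (- (\<psi> (1 / x))\<^sup>2 / 2) / (1 / x) / x\<^sup>2)" for x
    using Feq[of x] F0[of x] by (auto simp: indicator_def e_def power2_eq_square)
  ultimately have integrable: "set_integrable lebesgue {0..1} (F M \<psi>)"
    unfolding set_integrable_def by simp
  obtain N where N: "N \<ge> M" "N \<ge> 1" "\<And>x. x > N \<Longrightarrow> \<psi> x \<ge> 1"
    using Psi_threshold_eventually_ge_1[OF assms] by blast
  \<comment> \<open>For \<epsilon> < e' one has 1/\<epsilon> > N, so \<psi>(1/\<epsilon>) >= 1, the
    range where x exp(-x^2/2) decreases. Using N + 1 instead of N makes e' strictly smaller than
    both 1 and \<open>e\<close>.\<close>
  define e' where "e' = 1 / (N + 1)"
  have e': "0 < e'" "e' < 1" "e' < e" using N M by (auto simp: e'_def e field_simps)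
  have gtN: "1 / \<epsilon> > N" if "\<epsilon> \<in> {0<..<e'}" for \<epsilon>
    using that N by (auto simp: e'_def field_simps)
  have "d \<le> F M \<psi> \<epsilon>" if "\<epsilon> \<in> {0<..<e'}" for \<epsilon>
    using that e' Feq[of \<epsilon>] d(2)[OF gtM, of \<epsilon>] by auto
  moreover have "mono_on {0<..<e'} (\<lambda>\<epsilon>. \<epsilon> * F M \<psi> \<epsilon>)"
  proof (rule mono_onI)
    fix r s assume rs: "r \<in> {0<..<e'}" "s \<in> {0<..<e'}" "r \<le> s"
    then have "1 / s \<le> 1 / r" by (auto simp: field_simps)
    then have "\<psi> (1 / s) \<le> \<psi> (1 / r)"
      using gtN[OF rs(1)] gtN[OF rs(2)] N(1) by (intro mono_onD[OF mono]) auto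
    then have "\<psi> (1 / r) * exp (- (\<psi> (1 / r))\<^sup>2 / 2) \<le> \<psi> (1 / s) * exp (- (\<psi> (1 / s))\<^sup>2 / 2)"
      using N(3)[OF gtN[OF rs(2)]] by (intro mult_exp_neg_square_antimono)
    then show "r * F M \<psi> r \<le> s * F M \<psi> s"
      using rs e' Feq[of r] Feq[of s] by auto
  qed
  ultimately have "e' \<in> {0<..<1}" "d > 0" "\<forall>\<epsilon>\<in>{0<..<e'}. F M \<psi> \<epsilon> \<ge> d"
    "mono_on {0<..<e'} (\<lambda>\<epsilon>. \<epsilon> * F M \<psi> \<epsilon>)"
    using e' d(1) by auto
  then show ?thesis unfolding Pi0_def using integrable ge0 by blast
qed

section \<open>The functional \<open>G\<close> maps into \<open>Psi_inf\<close>\<close>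

lemma beta_ge_1: "beta \<pi> \<epsilon> \<ge> 1"
  by (simp add: beta_def)

lemma G_pos: "G \<pi> x > 0"
  using beta_ge_1[of \<pi> "1 / x"] ln_ge_zero[OF beta_ge_1[of \<pi> "1 / x"]]
  by (auto simp: G_def intro!: add_pos_nonneg simp del: ln_ge_zero_iff)

lemma G_square: "(G \<pi> x)\<^sup>2 = beta \<pi> (1 / x) + ln (beta \<pi> (1 / x))"
  using beta_ge_1[of \<pi> "1 / x"] ln_ge_zero[OF beta_ge_1[of \<pi> "1 / x"]] by (simp add: G_def)

text \<open>The decreasing map b -> exp(-b/2) turns the maximum in \<open>beta\<close> into a
  minimum and undoes the logarithm.\<close>

lemma exp_beta:
  assumes "\<epsilon> * \<pi> \<epsilon> > 0"
  shows "exp (- beta \<pi> \<epsilon> / 2) = min (\<epsilon> * \<pi> \<epsilon>) (exp (- 1 / 2))"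
proof -
  have "exp (- beta \<pi> \<epsilon> / 2) = exp (min (ln (\<epsilon> * \<pi> \<epsilon>)) (- 1 / 2))"
    by (simp add: beta_def min_def max_def)
  also have "\<dots> = min (exp (ln (\<epsilon> * \<pi> \<epsilon>))) (exp (- 1 / 2))"
    by (simp add: min_def)
  finally show ?thesis using assms by simp
qed

text \<open>With \<epsilon> = 1/x, G exp(-G^2/2) lies between min(\<epsilon> \<pi>(\<epsilon>),
  exp(-1/2)) and exp(1/2) \<epsilon> \<pi>(\<epsilon>). The upper bound gives integrability by
  comparison with \<pi> after substitution, the lower bound gives the last condition on
  \<psi>.\<close>

lemma G_in_Psi_inf:
  assumes "\<pi> \<in> Pi0"
  shows "G \<pi> \<in> Psi_inf"
proof -
  have int: "set_integrable lebesgue {0..1} \<pi>" using assms by (auto simp: Pi0_def)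
  obtain e d where e: "0 < e" "e < 1" and d: "d > 0" "\<And>\<epsilon>. \<epsilon> \<in> {0<..<e} \<Longrightarrow> \<pi> \<epsilon> \<ge> d"
    and mono: "mono_on {0<..<e} (\<lambda>\<epsilon>. \<epsilon> * \<pi> \<epsilon>)"
    using assms by (auto simp: Pi0_def)
  define M where "M = 1 / e"
  have M: "M > 1" "e = 1 / M" using e by (auto simp: M_def)
  have in_e: "1 / x \<in> {0<..<e}" if "x > M" for x
  proof -
    have "x > 0" using that M by simp
    then show ?thesis using that e by (auto simp: M_def field_simps)
  qed
  have pos: "1 / x * \<pi> (1 / x) > 0" if "x > M" for x
    using in_e[OF that] d(1) d(2)[OF in_e[OF that]] by (auto intro!: divide_pos_pos)
  have monoG: "mono_on {M<..} (G \<pi>)"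
  proof (rule mono_onI)
    fix r s assume rs: "r \<in> {M<..}" "s \<in> {M<..}" "r \<le> s"
    then have "1 / s \<le> 1 / r" using M by (auto simp: field_simps)
    then have "1 / s * \<pi> (1 / s) \<le> 1 / r * \<pi> (1 / r)"
      using rs in_e by (intro mono_onD[OF mono]) auto
    then have "ln (1 / s * \<pi> (1 / s)) \<le> ln (1 / r * \<pi> (1 / r))"
      using pos rs by (subst ln_le_cancel_iff) auto
    then have b: "beta \<pi> (1 / r) \<le> beta \<pi> (1 / s)" unfolding beta_def by linarith
    moreover have "ln (beta \<pi> (1 / r)) \<le> ln (beta \<pi> (1 / s))"
      using b beta_ge_1[of \<pi> "1 / r"] by simp
    ultimately show "G \<pi> r \<le> G \<pi> s" unfolding G_def by simp
  qed
  have bounds: "min (1 / x * \<pi> (1 / x)) (exp (- 1 / 2)) \<le> G \<pi> x * exp (- (G \<pi> x)\<^sup>2 / 2)"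
    "G \<pi> x * exp (- (G \<pi> x)\<^sup>2 / 2) \<le> exp (1 / 2) * (1 / x * \<pi> (1 / x))" if "x > M" for x
  proof -
    note * = mult_exp_sqrt_plus_ln_bounds[OF beta_ge_1[of \<pi> "1 / x"], folded G_def]
    note eb = exp_beta[of "1 / x" \<pi>, OF pos[OF that]]
    show "min (1 / x * \<pi> (1 / x)) (exp (- 1 / 2)) \<le> G \<pi> x * exp (- (G \<pi> x)\<^sup>2 / 2)"
      using *(1) unfolding eb .
    have "exp (1 / 2) * exp (- beta \<pi> (1 / x) / 2) \<le> exp (1 / 2) * (1 / x * \<pi> (1 / x))"
      unfolding eb by (intro mult_left_mono) auto
    then show "G \<pi> x * exp (- (G \<pi> x)\<^sup>2 / 2) \<le> exp (1 / 2) * (1 / x * \<pi> (1 / x))"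
      using *(2) by linarith
  qed
  have "set_integrable lebesgue {0<..<1 / M} \<pi>"
    using e unfolding M(2)[symmetric] by (intro set_integrable_subset[OF int]) auto
  then have "set_integrable lebesgue {M<..} (\<lambda>x. \<pi> (1 / x) / x\<^sup>2)"
    using M by (subst set_integrable_inverse_substitution[symmetric])
      (auto simp: image_inverse_greaterThan)
  then have dom: "set_integrable lebesgue {M<..} (\<lambda>x. exp (1 / 2) * (\<pi> (1 / x) / x\<^sup>2))"
    by (intro set_integrable_mult_right)
  have integrable: "set_integrable lebesgue {M<..} (\<lambda>x. G \<pi> x * exp (- (G \<pi> x)\<^sup>2 / 2) / x)"
  proof (rule set_integrable_bound[OF dom])
    have [measurable]: "(\<lambda>x. x) \<in> borel_measurable (restrict_space borel {M<..})"
      by (intro measurable_restrict_space1) simp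
    \<comment> \<open>Measurability of \<open>G \<pi>\<close> comes from its monotonicity on (M,
      infinity), not from measurability of \<pi>.\<close>
    have [measurable]: "G \<pi> \<in> borel_measurable (restrict_space borel {M<..})"
      by (rule borel_measurable_mono_on_fnc[OF monoG])
    have "(\<lambda>x. G \<pi> x * exp (- (G \<pi> x)\<^sup>2 / 2) / x) \<in> borel_measurable (restrict_space borel {M<..})"
      by measurable
    then have "(\<lambda>x. indicator {M<..} x *\<^sub>R (G \<pi> x * exp (- (G \<pi> x)\<^sup>2 / 2) / x)) \<in> borel_measurable borel"
      by (subst (asm) borel_measurable_restrict_space_iff) (auto simp: mult.commute)
    then show "set_borel_measurable lebesgue {M<..} (\<lambda>x. G \<pi> x * exp (- (G \<pi> x)\<^sup>2 / 2) / x)"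
      unfolding set_borel_measurable_def by (intro measurable_completion) simp
    show "AE x in lebesgue. x \<in> {M<..} \<longrightarrow>
        norm (G \<pi> x * exp (- (G \<pi> x)\<^sup>2 / 2) / x) \<le> norm (exp (1 / 2) * (\<pi> (1 / x) / x\<^sup>2))"
    proof (intro AE_I2 impI)
      fix x assume "x \<in> {M<..}"
      then have x: "x > M" by simp
      have "G \<pi> x * exp (- (G \<pi> x)\<^sup>2 / 2) / x \<le> exp (1 / 2) * (1 / x * \<pi> (1 / x)) / x"
        using bounds(2)[OF x] x M by (intro divide_right_mono) auto
      also have "\<dots> = exp (1 / 2) * (\<pi> (1 / x) / x\<^sup>2)" by (simp add: power2_eq_square)
      also have "\<dots> \<le> norm (exp (1 / 2) * (\<pi> (1 / x) / x\<^sup>2))" unfolding real_norm_def by (rule abs_ge_self)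
      finally show "norm (G \<pi> x * exp (- (G \<pi> x)\<^sup>2 / 2) / x) \<le> norm (exp (1 / 2) * (\<pi> (1 / x) / x\<^sup>2))"
        using G_pos[of \<pi> x] x M by simp
    qed
  qed
  \<comment> \<open>Halving makes the final inequality strict. The term exp(-1/2) covers the case
    where the minimum is attained by the cut-off, using x > M > 1.\<close>
  define d' where "d' = min d (exp (- 1 / 2)) / 2"
  have d': "d' > 0" "d' < d" "d' < exp (- 1 / 2)" using d(1) by (auto simp: d'_def min_def)
  have "d' < x * G \<pi> x * exp (- (G \<pi> x)\<^sup>2 / 2)" if x: "x > M" for x
  proof -
    have "d' < \<pi> (1 / x)" using d(2)[OF in_e[OF x]] d' by simp
    moreover have "1 * exp (- 1 / 2) \<le> x * exp (- 1 / 2 :: real)"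
      using x M by (intro mult_right_mono) auto
    ultimately have "d' < \<pi> (1 / x)" "d' < x * exp (- 1 / 2)" using d'(3) by linarith+
    then have "d' < x * min (1 / x * \<pi> (1 / x)) (exp (- 1 / 2))"
      using x M by (auto simp: min_def)
    also have "\<dots> \<le> x * (G \<pi> x * exp (- (G \<pi> x)\<^sup>2 / 2))"
      using bounds(1)[OF x] x M by (intro mult_left_mono) auto
    finally show ?thesis by (simp add: mult.assoc)
  qed
  then have "Psi_threshold M (G \<pi>)"
    unfolding Psi_threshold_def using M d' monoG integrable G_pos
    by (auto intro!: exI[of _ d'])
  then show ?thesis by (auto simp: Psi_inf_def)
qed

section \<open>Compatibility with the relations and inversion up to equivalence\<close>

lemma eventually_F_eq:
  assumes "M > 0"
  shows "\<forall>\<^sub>F x in at_top. F M \<psi> (1 / x) = x * \<psi> x * exp (- (\<psi> x)\<^sup>2 / 2)"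
  using eventually_gt_at_top[of "max 1 M"]
  by eventually_elim (use assms in \<open>auto simp: F_def field_simps\<close>)

lemma eventually_ln_F:
  assumes "M > 0" "\<forall>\<^sub>F x in at_top. \<psi> x > 0"
  shows "\<forall>\<^sub>F x in at_top. ln (F M \<psi> (1 / x)) = ln x + ln (\<psi> x) - (\<psi> x)\<^sup>2 / 2"
  using eventually_F_eq[OF assms(1), of \<psi>] assms(2) eventually_gt_at_top[of 0]
  by eventually_elim (simp add: ln_mult)

lemma eventually_at_right_0_iff_at_top:
  "eventually P (at_right (0::real)) \<longleftrightarrow> (\<forall>\<^sub>F x in at_top. P (1 / x))"
  by (simp add: eventually_at_right_to_top inverse_eq_divide)

text \<open>The factor 1/\<epsilon> cancels, leaving the change of ln \<psi> - \<psi>^2/2. The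
  thresholds may differ, since the cut-off does not affect \<open>F\<close> close to 0.\<close>

lemma F_respects:
  assumes "Psi_threshold M1 \<psi>1" "Psi_threshold M2 \<psi>2" "(\<psi>1, \<psi>2) \<in> sim_inf"
  shows "(F M1 \<psi>1, F M2 \<psi>2) \<in> sim0"
proof -
  have in_Psi: "\<psi>1 \<in> Psi_inf" "\<psi>2 \<in> Psi_inf" and M: "M1 > 0" "M2 > 0"
    using assms by (auto simp: Psi_inf_def Psi_threshold_def)
  obtain K where K: "\<forall>\<^sub>F x in at_top. \<bar>(\<psi>2 x)\<^sup>2 - (\<psi>1 x)\<^sup>2\<bar> \<le> K"
    using assms(3) by (auto simp: sim_inf_eq)
  note ge1 = in_Psi[THEN Psi_inf_eventually_ge_1]
  have "\<forall>\<^sub>F x in at_top. \<psi>1 x > 0" "\<forall>\<^sub>F x in at_top. \<psi>2 x > 0"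
    using ge1 by (auto elim: eventually_mono)
  note lnF = eventually_ln_F[OF M(1) this(1)] eventually_ln_F[OF M(2) this(2)]
  have "\<forall>\<^sub>F x in at_top. \<bar>ln (F M2 \<psi>2 (1 / x)) - ln (F M1 \<psi>1 (1 / x))\<bar> \<le> K"
    using K ge1 lnF
  proof eventually_elim
    case (elim x)
    \<comment> \<open>Applying the Lipschitz bound to the squares shows that ln \<psi> changes by at
      most K/2, as does \<psi>^2/2; together they give K.\<close>
    have "\<bar>ln ((\<psi>2 x)\<^sup>2) - ln ((\<psi>1 x)\<^sup>2)\<bar> \<le> \<bar>(\<psi>2 x)\<^sup>2 - (\<psi>1 x)\<^sup>2\<bar>"
      using elim by (intro ln_abs_diff_le) (auto intro: one_le_power)
    then have "2 * \<bar>ln (\<psi>2 x) - ln (\<psi>1 x)\<bar> \<le> \<bar>(\<psi>2 x)\<^sup>2 - (\<psi>1 x)\<^sup>2\<bar>"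
      using elim by (simp add: ln_realpow abs_if split: if_splits)
    then have "2 * \<bar>ln (\<psi>2 x) - ln (\<psi>1 x)\<bar> \<le> K" using elim(1) by linarith
    moreover have "ln (F M2 \<psi>2 (1 / x)) - ln (F M1 \<psi>1 (1 / x)) =
        (ln (\<psi>2 x) - ln (\<psi>1 x)) - ((\<psi>2 x)\<^sup>2 - (\<psi>1 x)\<^sup>2) / 2"
      using elim(4,5) by (simp add: field_simps)
    moreover have "\<bar>(ln (\<psi>2 x) - ln (\<psi>1 x)) - ((\<psi>2 x)\<^sup>2 - (\<psi>1 x)\<^sup>2) / 2\<bar> \<le>
        \<bar>ln (\<psi>2 x) - ln (\<psi>1 x)\<bar> + \<bar>(\<psi>2 x)\<^sup>2 - (\<psi>1 x)\<^sup>2\<bar> / 2"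
      using abs_triangle_ineq4[of "ln (\<psi>2 x) - ln (\<psi>1 x)" "((\<psi>2 x)\<^sup>2 - (\<psi>1 x)\<^sup>2) / 2"] by simp
    ultimately show ?case using elim(1) by (simp only:) simp
  qed
  then show ?thesis
    unfolding sim0_eq using assms(1,2)
    by (auto simp: F_in_Pi0 eventually_at_right_0_iff_at_top)
qed

text \<open>The term ln x cancels and the maximum with 1 is 1-Lipschitz, so \<open>beta\<close>
  changes by at most 2K; its logarithm changes by no more than that, whence 4K.\<close>

lemma G_respects:
  assumes "(\<pi>1, \<pi>2) \<in> sim0"
  shows "(G \<pi>1, G \<pi>2) \<in> sim_inf"
proof -
  have in_Pi: "\<pi>1 \<in> Pi0" "\<pi>2 \<in> Pi0" using assms by (auto simp: sim0_eq)
  obtain K where K: "\<forall>\<^sub>F x in at_top. \<bar>ln (\<pi>2 (1 / x)) - ln (\<pi>1 (1 / x))\<bar> \<le> K"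
    using assms by (auto simp: sim0_eq eventually_at_right_0_iff_at_top)
  have "\<forall>\<^sub>F x in at_top. \<bar>(G \<pi>2 x)\<^sup>2 - (G \<pi>1 x)\<^sup>2\<bar> \<le> 4 * K"
    using K in_Pi[THEN Pi0_eventually_pos, unfolded eventually_at_right_0_iff_at_top]
      eventually_gt_at_top[of 0]
  proof eventually_elim
    case (elim x)
    have "ln (1 / x * \<pi>2 (1 / x)) = ln (\<pi>2 (1 / x)) - ln x" "ln (1 / x * \<pi>1 (1 / x)) = ln (\<pi>1 (1 / x)) - ln x"
      using elim by (simp_all add: ln_div)
    then have "\<bar>beta \<pi>2 (1 / x) - beta \<pi>1 (1 / x)\<bar> \<le> 2 * K"
      unfolding beta_def using elim(1) by linarith
    moreover have "\<bar>ln (beta \<pi>2 (1 / x)) - ln (beta \<pi>1 (1 / x))\<bar> \<le> \<bar>beta \<pi>2 (1 / x) - beta \<pi>1 (1 / x)\<bar>"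
      by (intro ln_abs_diff_le beta_ge_1)
    ultimately show ?case unfolding G_square by linarith
  qed
  then show ?thesis unfolding sim_inf_eq using in_Pi by (auto simp: G_in_Psi_inf)
qed

text \<open>For t = \<psi>^2, \<open>beta\<close> equals t - ln t: the maximum with 1 has no effect
  because ln t <= t - 1. Hence G^2 - \<psi>^2 = ln (t - ln t) - ln t, which lies in [-ln 2, 0] since
  t/2 <= t - ln t <= t.\<close>

lemma G_F_sim_inf:
  assumes "Psi_threshold M \<psi>"
  shows "(\<psi>, G (F M \<psi>)) \<in> sim_inf"
proof -
  have in_Psi: "\<psi> \<in> Psi_inf" and M: "M > 0"
    using assms by (auto simp: Psi_inf_def Psi_threshold_def)
  note ge1 = Psi_inf_eventually_ge_1[OF in_Psi]
  have "\<forall>\<^sub>F x in at_top. \<bar>(G (F M \<psi>) x)\<^sup>2 - (\<psi> x)\<^sup>2\<bar> \<le> 1"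
    using ge1 eventually_F_eq[OF M, of \<psi>] eventually_gt_at_top[of 0]
  proof eventually_elim
    case (elim x)
    define t where "t = (\<psi> x)\<^sup>2"
    have t: "t \<ge> 1" "ln t = 2 * ln (\<psi> x)"
      using elim by (auto simp: t_def ln_realpow intro: one_le_power)
    have "1 / x * F M \<psi> (1 / x) = \<psi> x * exp (- (\<psi> x)\<^sup>2 / 2)" using elim by simp
    also have "ln \<dots> = ln t / 2 - t / 2" using elim t(2) by (simp add: ln_mult t_def)
    finally have "beta (F M \<psi>) (1 / x) = max (t - ln t) 1" by (simp add: beta_def)
    moreover have "t - ln t \<ge> 1" using ln_le_minus_one[of t] t by simp
    ultimately have b: "beta (F M \<psi>) (1 / x) = t - ln t" by simp
    have "t / 2 \<le> t - ln t" "t - ln t \<le> t" using ln_le_half[of t] ln_ge_zero[of t] t(1) by linarith+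
    then have "ln (t / 2) \<le> ln (t - ln t)" "ln (t - ln t) \<le> ln t"
      using t(1) by (subst ln_le_cancel_iff; simp)+
    moreover have "ln (t / 2) = ln t - ln 2" using t by (simp add: ln_div)
    moreover have "ln (2::real) \<le> 2 - 1" by (rule ln_le_minus_one) simp
    ultimately show ?case unfolding G_square b t_def[symmetric] by linarith
  qed
  then show ?thesis
    unfolding sim_inf_eq using in_Psi F_in_Pi0[OF assms] by (auto simp: G_in_Psi_inf)
qed

lemma F_G_sim0:
  assumes "\<pi> \<in> Pi0" "Psi_threshold M (G \<pi>)"
  shows "(\<pi>, F M (G \<pi>)) \<in> sim0"
proof -
  obtain e where e: "0 < e" and mono: "mono_on {0<..<e} (\<lambda>\<epsilon>. \<epsilon> * \<pi> \<epsilon>)"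
    using assms(1) by (auto simp: Pi0_def)
  \<comment> \<open>By monotonicity the value at e/2 bounds ln (\<epsilon> \<pi>(\<epsilon>)) for
    smaller \<epsilon>. This controls the cut-off in \<open>beta\<close> without showing that
    \<epsilon> \<pi>(\<epsilon>) tends to 0.\<close>
  define L where "L = ln (e / 2 * \<pi> (e / 2))"
  have M: "M > 0" using assms(2) by (simp add: Psi_threshold_def)
  have "\<forall>\<^sub>F x in at_top. \<bar>ln (F M (G \<pi>) (1 / x)) - ln (\<pi> (1 / x))\<bar> \<le> 1 + \<bar>L\<bar>"
    using eventually_ln_F[where \<psi> = "G \<pi>", OF M always_eventually[OF allI[OF G_pos]]]
      Pi0_eventually_pos[OF assms(1), unfolded eventually_at_right_0_iff_at_top]
      eventually_gt_at_top[of "2 / e"]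
  proof eventually_elim
    case (elim x)
    have x: "x > 0" using elim e by (meson divide_pos_pos less_trans zero_less_numeral)
    have "1 / x \<le> e / 2" using elim(3) x e by (simp add: field_simps)
    then have "1 / x * \<pi> (1 / x) \<le> e / 2 * \<pi> (e / 2)"
      using x e by (intro mono_onD[OF mono]) auto
    moreover have "0 < 1 / x * \<pi> (1 / x)" using x elim(2) by simp
    ultimately have L: "ln (1 / x * \<pi> (1 / x)) \<le> L"
      unfolding L_def by (subst ln_le_cancel_iff) linarith+
    have ln: "ln (1 / x * \<pi> (1 / x)) = ln (\<pi> (1 / x)) - ln x"
      using x elim(2) by (simp add: ln_div)
    note * = ln_sqrt_plus_ln_bounds[OF beta_ge_1[of \<pi> "1 / x"], folded G_def]
    \<comment> \<open>For l = ln (\<epsilon> \<pi>(\<epsilon>)), -beta/2 is min(l, -1/2), which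
      differs from l only if -1/2 < l <= L.\<close>
    have "- beta \<pi> (1 / x) / 2 - ln (1 / x * \<pi> (1 / x)) \<le> 0"
      "- beta \<pi> (1 / x) / 2 - ln (1 / x * \<pi> (1 / x)) \<ge> - 1 / 2 - \<bar>L\<bar>"
      unfolding beta_def using L by linarith+
    then show ?case using * elim(1) unfolding ln by (intro abs_leI; linarith)
  qed
  then show ?thesis
    unfolding sim0_eq using assms by (auto simp: F_in_Pi0 eventually_at_right_0_iff_at_top)
qed

text \<open>\<open>M\<close> is an arbitrary choice of thresholds, so the result holds for every
  admissible cut-off in \<open>F\<close>.\<close>

theorem theorem5p8:
  fixes M :: "(real \<Rightarrow> real) \<Rightarrow> real"
  assumes M: "\<And>\<psi>. \<psi> \<in> Psi_inf \<Longrightarrow> Psi_threshold (M \<psi>) \<psi>"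
  defines "FM \<equiv> (\<lambda>\<psi>. F (M \<psi>) \<psi>)"
  shows "equiv Psi_inf sim_inf \<and> equiv Pi0 sim0 \<and>
    FM \<in> Psi_inf \<rightarrow> Pi0 \<and> G \<in> Pi0 \<rightarrow> Psi_inf \<and>
    (\<forall>(\<psi>1, \<psi>2)\<in>sim_inf. (FM \<psi>1, FM \<psi>2) \<in> sim0) \<and>
    (\<forall>(\<pi>1, \<pi>2)\<in>sim0. (G \<pi>1, G \<pi>2) \<in> sim_inf) \<and>
    bij_betw (induced sim0 FM) (Psi_inf // sim_inf) (Pi0 // sim0) \<and>
    bij_betw (induced sim_inf G) (Pi0 // sim0) (Psi_inf // sim_inf) \<and>
    (\<forall>X\<in>Psi_inf // sim_inf. induced sim_inf G (induced sim0 FM X) = X) \<and>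
    (\<forall>Y\<in>Pi0 // sim0. induced sim0 FM (induced sim_inf G Y) = Y)"
proof -
  have th: "Psi_threshold (M \<psi>) \<psi>" if "\<psi> \<in> Psi_inf" for \<psi> using M that .
  have R: "equiv Psi_inf sim_inf"
    unfolding sim_inf_eq using equiv_bounded_difference[where h = "\<lambda>\<psi> x. (\<psi> x)\<^sup>2"] .
  have S: "equiv Pi0 sim0"
    unfolding sim0_eq using equiv_bounded_difference[where h = "\<lambda>\<pi> \<epsilon>. ln (\<pi> \<epsilon>)"] .
  have F: "FM \<in> Psi_inf \<rightarrow> Pi0" unfolding FM_def using F_in_Pi0 th by blast
  have G: "G \<in> Pi0 \<rightarrow> Psi_inf" using G_in_Psi_inf by blast
  have FR: "(FM \<psi>1, FM \<psi>2) \<in> sim0" if "(\<psi>1, \<psi>2) \<in> sim_inf" for \<psi>1 \<psi>2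
    unfolding FM_def using that by (intro F_respects th) (auto simp: sim_inf_def)
  have GF: "(\<psi>, G (FM \<psi>)) \<in> sim_inf" if "\<psi> \<in> Psi_inf" for \<psi>
    unfolding FM_def using G_F_sim_inf[OF th[OF that]] .
  have FG: "(\<pi>, FM (G \<pi>)) \<in> sim0" if "\<pi> \<in> Pi0" for \<pi>
    unfolding FM_def using F_G_sim0[OF that th] G_in_Psi_inf[OF that] by blast
  note inverse = induced_mutually_inverse[where f = FM and g = G, OF R S F G FR G_respects GF FG]
  show ?thesis
    by (intro conjI R S F G inverse) (auto intro: FR G_respects)
qed

end
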